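(* Let $(X,d)$ be a nonempty pseudometric space and let $\{X_j : j\in J\}$ be the partition of $X$ into the equivalence classes of the relation $\sim_d$ (where $x\sim_d y$ iff $d(x,y)=0$), the blocks being indexed so that $X_{j_1}\neq X_{j_2}$ for $j_1\ne j_2$. Then $(X,d)\in\mathcal{IP}$ if and only if $|X_{j_1}|\neq |X_{j_2}|$ holds whenever $j_1,j_2\in J$ are distinct and, in addition, at least one of the following conditions is fulfilled: (i) $(X,d)$ is strongly rigid; (ii) $(X,d)$ is discrete; (iii) $(X,d)$ is a pseudorectangle.
   Context: A pseudometric on a set $X$ is a function $d\colon X^2\to\mathbb{R}$ that is non-negative, symmetric, satisfies $d(x,x)=0$ for all $x$, and satisfies the triangle inequality. Write $d(X^2)=\{d(x,y):x,y\in X\}$. The relation $x\sim_d y :\Leftrightarrow d(x,y)=0$ is an equivalence relation on $X$; the metric reflection of $(X,d)$ is the metric space $(X/{\sim_d},\delta_d)$ with $\delta_d(\alpha,\beta)=d(x,y)$ for $x\in\alpha$, $y\in\beta$ (well defined). A combinatorial self-similarity of $(X,d)$ is a bijection $\Psi\colon X\to X$ for which there is a bijection $f\colon d(X^2)\to d(X^2)$ with $d(x,y)=f(d(\Psi(x),\Psi(y)))$ for all $x,y\in X$; $\mathbf{Cs}(X,d)$ is the group of all of them. A pseudoidentity of $(X,d)$ is a bijection $f\colon X\to X$ with $d(x,f(x))=0$ for all $x\in X$; $\mathbf{PI}(X,d)$ is the group of all of them. $\mathbf{Sym}(X)$ is the group of all permutations of $X$. The class $\mathcal{IP}$ consists of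 all pseudometric spaces $(X,d)$ with $\mathbf{Cs}(X,d)=\mathbf{PI}(X,d)$ and $\mathbf{Cs}(X/{\sim_d},\delta_d)=\mathbf{Sym}(X/{\sim_d})$. A metric subspace of a pseudometric space $(X,d)$ is a subset $Y\subseteq X$ such that $d|_{Y^2}$ is a metric. A metric space is strongly rigid if $d(x,y)=d(u,v)\neq 0$ implies $\{x,y\}=\{u,v\}$; a metric space is discrete if its distance function takes at most two values, $|d(X^2)|\le 2$. A pseudometric space is strongly rigid (resp. discrete) if all its metric subspaces are strongly rigid (resp. discrete). A pseudometric space $(X,d)$ is a pseudorectangle if all three-point metric subspaces of $(X,d)$ are strongly rigid and pairwise isometric and, in addition, there is a four-point metric subspace $Y$ of $(X,d)$ such that for every $x\in X$ there is $y\in Y$ with $d(x,y)=0$. $|A|$ denotes the cardinality of a set $A$. *)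

theory Defs
  imports Complex_Main "HOL-Library.Equipollence" "HOL-Algebra.Bij"
begin

text \<open>
  A space is a pair of a carrier set \<open>X\<close> and a distance function \<open>d\<close> on the ambient type; only the
  values of \<open>d\<close> on \<open>X\<close> matter.  (The library locale for metric spaces constrains the distance
  outside the carrier as well.)
\<close>

definition pseudometric_on :: "'a set \<Rightarrow> ('a \<Rightarrow> 'a \<Rightarrow> real) \<Rightarrow> bool" where
  "pseudometric_on X d \<longleftrightarrow>
     (\<forall>x\<in>X. \<forall>y\<in>X. 0 \<le> d x y) \<and>
     (\<forall>x\<in>X. \<forall>y\<in>X. d x y = d y x) \<and>
     (\<forall>x\<in>X. d x x = 0) \<and>
     (\<forall>x\<in>X. \<forall>y\<in>X. \<forall>z\<in>X. d x z \<le> d x y + d y z)"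

definition metric_on :: "'a set \<Rightarrow> ('a \<Rightarrow> 'a \<Rightarrow> real) \<Rightarrow> bool" where
  "metric_on X d \<longleftrightarrow> pseudometric_on X d \<and> (\<forall>x\<in>X. \<forall>y\<in>X. d x y = 0 \<longrightarrow> x = y)"

definition distance_set :: "'a set \<Rightarrow> ('a \<Rightarrow> 'a \<Rightarrow> real) \<Rightarrow> real set" where
  "distance_set X d = {d x y | x y. x \<in> X \<and> y \<in> X}"

definition zero_dist_rel :: "'a set \<Rightarrow> ('a \<Rightarrow> 'a \<Rightarrow> real) \<Rightarrow> ('a \<times> 'a) set" where
  "zero_dist_rel X d = {(x, y). x \<in> X \<and> y \<in> X \<and> d x y = 0}"

definition reflection_dist :: "('a \<Rightarrow> 'a \<Rightarrow> real) \<Rightarrow> 'a set \<Rightarrow> 'a set \<Rightarrow> real" where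
  "reflection_dist d A B = (THE r. \<exists>x\<in>A. \<exists>y\<in>B. r = d x y)"

text \<open>
  \<^const>\<open>Bij\<close> \<open>X\<close>, the carrier of \<^const>\<open>BijGroup\<close> \<open>X\<close>, plays the role of \<open>Sym(X)\<close>: it consists of
  the bijections of \<open>X\<close> onto itself with a fixed dummy value outside \<open>X\<close>, so that equality of
  functions is equality on \<open>X\<close>.  The groups \<open>Cs\<close> and \<open>PI\<close> are given by their underlying sets,
  which are subgroups of \<^const>\<open>BijGroup\<close> \<open>X\<close> (see below).
\<close>

definition Cs :: "'a set \<Rightarrow> ('a \<Rightarrow> 'a \<Rightarrow> real) \<Rightarrow> ('a \<Rightarrow> 'a) set" where
  "Cs X d = {\<psi> \<in> Bij X. \<exists>f. bij_betw f (distance_set X d) (distance_set X d) \<and>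
                            (\<forall>x\<in>X. \<forall>y\<in>X. d x y = f (d (\<psi> x) (\<psi> y)))}"

definition PI :: "'a set \<Rightarrow> ('a \<Rightarrow> 'a \<Rightarrow> real) \<Rightarrow> ('a \<Rightarrow> 'a) set" where
  "PI X d = {f \<in> Bij X. \<forall>x\<in>X. d x (f x) = 0}"

definition IP :: "('a set \<times> ('a \<Rightarrow> 'a \<Rightarrow> real)) set" where
  "IP = {(X, d). pseudometric_on X d \<and> Cs X d = PI X d \<and>
           Cs (X // zero_dist_rel X d) (reflection_dist d) = Bij (X // zero_dist_rel X d)}"

definition metric_subspace :: "'a set \<Rightarrow> 'a set \<Rightarrow> ('a \<Rightarrow> 'a \<Rightarrow> real) \<Rightarrow> bool" where
  "metric_subspace Y X d \<longleftrightarrow> Y \<subseteq> X \<and> metric_on Y d"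

definition strongly_rigid_metric :: "'a set \<Rightarrow> ('a \<Rightarrow> 'a \<Rightarrow> real) \<Rightarrow> bool" where
  "strongly_rigid_metric Y d \<longleftrightarrow>
     metric_on Y d \<and>
     (\<forall>x\<in>Y. \<forall>y\<in>Y. \<forall>u\<in>Y. \<forall>v\<in>Y. d x y = d u v \<and> d u v \<noteq> 0 \<longrightarrow> {x, y} = {u, v})"

text \<open>Finiteness is explicit because \<^const>\<open>card\<close> is \<open>0\<close> on infinite sets.\<close>

definition discrete_metric :: "'a set \<Rightarrow> ('a \<Rightarrow> 'a \<Rightarrow> real) \<Rightarrow> bool" where
  "discrete_metric Y d \<longleftrightarrow>
     metric_on Y d \<and> finite (distance_set Y d) \<and> card (distance_set Y d) \<le> 2"

definition strongly_rigid :: "'a set \<Rightarrow> ('a \<Rightarrow> 'a \<Rightarrow> real) \<Rightarrow> bool" where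
  "strongly_rigid X d \<longleftrightarrow> (\<forall>Y. metric_subspace Y X d \<longrightarrow> strongly_rigid_metric Y d)"

definition discrete_pseudometric :: "'a set \<Rightarrow> ('a \<Rightarrow> 'a \<Rightarrow> real) \<Rightarrow> bool" where
  "discrete_pseudometric X d \<longleftrightarrow> (\<forall>Y. metric_subspace Y X d \<longrightarrow> discrete_metric Y d)"

definition isometric_sets :: "('a \<Rightarrow> 'a \<Rightarrow> real) \<Rightarrow> 'a set \<Rightarrow> 'a set \<Rightarrow> bool" where
  "isometric_sets d Y Z \<longleftrightarrow>
     (\<exists>h. bij_betw h Y Z \<and> (\<forall>x\<in>Y. \<forall>y\<in>Y. d (h x) (h y) = d x y))"

definition pseudorectangle :: "'a set \<Rightarrow> ('a \<Rightarrow> 'a \<Rightarrow> real) \<Rightarrow> bool" where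
  "pseudorectangle X d \<longleftrightarrow>
     (\<forall>Y. metric_subspace Y X d \<and> card Y = 3 \<longrightarrow> strongly_rigid_metric Y d) \<and>
     (\<forall>Y Z. metric_subspace Y X d \<and> card Y = 3 \<and> metric_subspace Z X d \<and> card Z = 3
        \<longrightarrow> isometric_sets d Y Z) \<and>
     (\<exists>Y. metric_subspace Y X d \<and> card Y = 4 \<and> (\<forall>x\<in>X. \<exists>y\<in>Y. d x y = 0))"

lemma equiv_zero_dist_rel:
  assumes "pseudometric_on X d"
  shows "equiv X (zero_dist_rel X d)"
proof (rule equivI)
  show "zero_dist_rel X d \<subseteq> X \<times> X" by (auto simp: zero_dist_rel_def)
  show "refl_on X (zero_dist_rel X d)"
    using assms by (auto simp: refl_on_def zero_dist_rel_def pseudometric_on_def)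
  show "sym (zero_dist_rel X d)"
    using assms by (auto simp: sym_def zero_dist_rel_def pseudometric_on_def)
  show "trans (zero_dist_rel X d)"
  proof (rule transI)
    fix x y z assume "(x, y) \<in> zero_dist_rel X d" "(y, z) \<in> zero_dist_rel X d"
    then have m: "x \<in> X" "y \<in> X" "z \<in> X" and z: "d x y = 0" "d y z = 0"
      by (auto simp: zero_dist_rel_def)
    have "d x z \<le> d x y + d y z" "0 \<le> d x z"
      using assms m unfolding pseudometric_on_def by blast+
    with z m show "(x, z) \<in> zero_dist_rel X d" by (simp add: zero_dist_rel_def)
  qed
qed

lemma reflection_dist_eq:
  assumes P: "pseudometric_on X d"
    and A: "A \<in> X // zero_dist_rel X d" and B: "B \<in> X // zero_dist_rel X d"
    and x: "x \<in> A" and y: "y \<in> B"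
  shows "reflection_dist d A B = d x y"
  unfolding reflection_dist_def
proof (rule the_equality)
  show "\<exists>x'\<in>A. \<exists>y'\<in>B. d x y = d x' y'" using x y by blast
next
  fix r assume "\<exists>x'\<in>A. \<exists>y'\<in>B. r = d x' y'"
  then obtain x' y' where x': "x' \<in> A" and y': "y' \<in> B" and r: "r = d x' y'" by blast
  have "(x, x') \<in> zero_dist_rel X d" "(y, y') \<in> zero_dist_rel X d"
    using quotient_eq_iff[OF equiv_zero_dist_rel[OF P] A A x x']
      quotient_eq_iff[OF equiv_zero_dist_rel[OF P] B B y y'] by auto
  then have m: "x \<in> X" "x' \<in> X" "y \<in> X" "y' \<in> X" and z: "d x x' = 0" "d y y' = 0"
    by (auto simp: zero_dist_rel_def)
  have tri: "d a c \<le> d a b + d b c" if "a \<in> X" "b \<in> X" "c \<in> X" for a b c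
    using P that unfolding pseudometric_on_def by blast
  have com: "d a b = d b a" if "a \<in> X" "b \<in> X" for a b
    using P that unfolding pseudometric_on_def by blast
  show "r = d x y"
    using tri[of x x' y] tri[of x' y' y] tri[of x' x y'] tri[of x y y'] m z
      com[of x x'] com[of y y'] r by simp
qed

lemma metric_on_reflection:
  assumes P: "pseudometric_on X d"
  shows "metric_on (X // zero_dist_rel X d) (reflection_dist d)"
proof -
  let ?Q = "X // zero_dist_rel X d"
  note E = equiv_zero_dist_rel[OF P]
  have ex: "\<exists>x. x \<in> A \<and> x \<in> X" if "A \<in> ?Q" for A
    using in_quotient_imp_non_empty[OF E that] in_quotient_imp_subset[OF E that] by blast
  define p where "p A = (SOME x. x \<in> A \<and> x \<in> X)" for A
  have p: "p A \<in> A \<and> p A \<in> X" if "A \<in> ?Q" for A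
    unfolding p_def by (rule someI_ex[OF ex[OF that]])
  have D: "reflection_dist d A B = d (p A) (p B)" if "A \<in> ?Q" "B \<in> ?Q" for A B
    using reflection_dist_eq[OF P that] p that by blast
  have "A = B" if "A \<in> ?Q" "B \<in> ?Q" "d (p A) (p B) = 0" for A B
    using quotient_eq_iff[OF E that(1,2), of "p A" "p B"] p that
    by (auto simp: zero_dist_rel_def)
  moreover have "pseudometric_on ?Q (reflection_dist d)"
    using P p unfolding pseudometric_on_def by (simp add: D)
  ultimately show ?thesis by (simp add: metric_on_def D)
qed

lemma subgroup_Cs: "subgroup (Cs X d) (BijGroup X)"
proof (rule group.subgroupI[OF group_BijGroup])
  show "Cs X d \<subseteq> carrier (BijGroup X)" by (auto simp: Cs_def BijGroup_def)
  have "(\<lambda>x\<in>X. x) \<in> Cs X d"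
    by (auto simp: Cs_def id_Bij intro!: exI[of _ id])
  then show "Cs X d \<noteq> {}" by blast
next
  fix g assume g: "g \<in> Cs X d"
  then obtain f where gB: "g \<in> Bij X" and f: "bij_betw f (distance_set X d) (distance_set X d)"
    and fd: "\<And>x y. x \<in> X \<Longrightarrow> y \<in> X \<Longrightarrow> d x y = f (d (g x) (g y))"
    by (auto simp: Cs_def)
  let ?D = "distance_set X d" and ?g = "restrict (inv_into X g) X"
  have gX: "bij_betw g X X" using gB by (simp add: Bij_def)
  have "d x y = inv_into ?D f (d (?g x) (?g y))" if m: "x \<in> X" "y \<in> X" for x y
  proof -
    have i: "?g x \<in> X" "?g y \<in> X" "g (?g x) = x" "g (?g y) = y"
      using m gX by (auto simp: Bij_inv_into_mem[OF gB] bij_betw_inv_into_right)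
    then have "d (?g x) (?g y) = f (d x y)" using fd[of "?g x" "?g y"] by simp
    moreover have "d x y \<in> ?D" using m by (auto simp: distance_set_def)
    ultimately show ?thesis using f by (simp add: bij_betw_inv_into_left)
  qed
  then have "?g \<in> Cs X d"
    unfolding Cs_def using restrict_inv_into_Bij[OF gB] bij_betw_inv_into[OF f] by blast
  then show "inv\<^bsub>BijGroup X\<^esub> g \<in> Cs X d" by (simp add: inv_BijGroup[OF gB])
next
  fix g h assume "g \<in> Cs X d" "h \<in> Cs X d"
  then obtain f k where B: "g \<in> Bij X" "h \<in> Bij X"
    and f: "bij_betw f (distance_set X d) (distance_set X d)"
      "\<And>x y. x \<in> X \<Longrightarrow> y \<in> X \<Longrightarrow> d x y = f (d (g x) (g y))"
    and k: "bij_betw k (distance_set X d) (distance_set X d)"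
      "\<And>x y. x \<in> X \<Longrightarrow> y \<in> X \<Longrightarrow> d x y = k (d (h x) (h y))"
    unfolding Cs_def by blast
  have hX: "h x \<in> X" if "x \<in> X" for x using Bij_imp_funcset[OF B(2)] that by auto
  have "d x y = (k \<circ> f) (d (compose X g h x) (compose X g h y))" if "x \<in> X" "y \<in> X" for x y
    using that hX k(2)[of x y] f(2)[of "h x" "h y"] by (simp add: compose_def)
  then have "compose X g h \<in> Cs X d"
    unfolding Cs_def using compose_Bij[OF B] bij_betw_trans[OF f(1) k(1)] by blast
  then show "g \<otimes>\<^bsub>BijGroup X\<^esub> h \<in> Cs X d" using B by (simp add: BijGroup_def)
qed

lemma subgroup_PI:
  assumes P: "pseudometric_on X d"
  shows "subgroup (PI X d) (BijGroup X)"
proof (rule group.subgroupI[OF group_BijGroup])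
  show "PI X d \<subseteq> carrier (BijGroup X)" by (auto simp: PI_def BijGroup_def)
  have "(\<lambda>x\<in>X. x) \<in> PI X d"
    using P by (auto simp: PI_def id_Bij pseudometric_on_def)
  then show "PI X d \<noteq> {}" by blast
next
  fix g assume g: "g \<in> PI X d"
  then have gB: "g \<in> Bij X" and z: "\<And>x. x \<in> X \<Longrightarrow> d x (g x) = 0" by (auto simp: PI_def)
  let ?g = "restrict (inv_into X g) X"
  have gX: "bij_betw g X X" using gB by (simp add: Bij_def)
  have "d x (?g x) = 0" if m: "x \<in> X" for x
  proof -
    have i: "?g x \<in> X" "g (?g x) = x"
      using m gX by (auto simp: Bij_inv_into_mem[OF gB] bij_betw_inv_into_right)
    have "d x (?g x) = d (?g x) x" using P i(1) m unfolding pseudometric_on_def by blast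
    then show ?thesis using z[OF i(1)] i(2) by simp
  qed
  then have "?g \<in> PI X d" unfolding PI_def using restrict_inv_into_Bij[OF gB] by blast
  then show "inv\<^bsub>BijGroup X\<^esub> g \<in> PI X d" by (simp add: inv_BijGroup[OF gB])
next
  fix g h assume "g \<in> PI X d" "h \<in> PI X d"
  then have B: "g \<in> Bij X" "h \<in> Bij X"
    and z: "\<And>x. x \<in> X \<Longrightarrow> d x (g x) = 0" "\<And>x. x \<in> X \<Longrightarrow> d x (h x) = 0"
    by (auto simp: PI_def)
  have "d x (compose X g h x) = 0" if x: "x \<in> X" for x
  proof -
    have hx: "h x \<in> X" using Bij_imp_funcset[OF B(2)] x by auto
    have gh: "g (h x) \<in> X" using Bij_imp_funcset[OF B(1)] hx by auto
    have "d x (g (h x)) \<le> d x (h x) + d (h x) (g (h x))" "0 \<le> d x (g (h x))"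
      using P x hx gh unfolding pseudometric_on_def by blast+
    then show ?thesis using z(1)[OF hx] z(2)[OF x] x by (simp add: compose_def)
  qed
  then have "compose X g h \<in> PI X d" unfolding PI_def using compose_Bij[OF B] by blast
  then show "g \<otimes>\<^bsub>BijGroup X\<^esub> h \<in> PI X d" using B by (simp add: BijGroup_def)
qed

end

theory Submission
  imports Defs "HOL-Combinatorics.Transposition"
begin

text \<open>
  A permutation is a combinatorial self-similarity iff it preserves and reflects equality of
  distances.  So in the metric reflection every permutation is a combinatorial self-similarity
  iff equality of distances is invariant under the full symmetric group.  If two edges with a
  common endpoint have equal length, multiple transitivity makes all edges equally long; if two
  disjoint edges have equal length and there is a fifth point, moving one endpoint to it
  produces two such edges.  What is left is the strongly rigid case and the four-point case in
  which exactly the opposite edges have equal length.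

  A combinatorial self-similarity of \<open>X\<close> maps blocks bijectively onto blocks, hence fixes every
  block if the blocks have distinct cardinalities.  Conversely, two equipotent blocks can be
  swapped, and this is a combinatorial self-similarity as soon as all permutations of the
  reflection are.
\<close>

section \<open>Elementary facts about metrics and permutations\<close>

lemma metric_onD:
  assumes "metric_on X d"
  shows "x \<in> X \<Longrightarrow> y \<in> X \<Longrightarrow> 0 \<le> d x y"
    and "x \<in> X \<Longrightarrow> y \<in> X \<Longrightarrow> d x y = d y x"
    and "x \<in> X \<Longrightarrow> y \<in> X \<Longrightarrow> d x y = 0 \<longleftrightarrow> x = y"
  using assms unfolding metric_on_def pseudometric_on_def by blast+

lemma metric_on_subset: "metric_on X d \<Longrightarrow> Y \<subseteq> X \<Longrightarrow> metric_on Y d"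
  unfolding metric_on_def pseudometric_on_def by (meson subsetD)

lemma Bij_bij_betw: "\<psi> \<in> Bij X \<Longrightarrow> bij_betw \<psi> X X"
  by (simp add: Bij_def)

lemma Bij_mem: "\<psi> \<in> Bij X \<Longrightarrow> x \<in> X \<Longrightarrow> \<psi> x \<in> X"
  using bij_betwE[OF Bij_bij_betw] by blast

lemma Bij_eq_iff: "\<psi> \<in> Bij X \<Longrightarrow> x \<in> X \<Longrightarrow> y \<in> X \<Longrightarrow> \<psi> x = \<psi> y \<longleftrightarrow> x = y"
  by (rule inj_on_eq_iff[OF bij_betw_imp_inj_on[OF Bij_bij_betw]])

section \<open>Self-similarities and equality of distances\<close>

text \<open>The map \<open>f\<close> in the definition of \<open>Cs\<close> is forced: it must send
  \<open>d (\<psi> x) (\<psi> y)\<close> to \<open>d x y\<close>. One direction of the equivalence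
  on the right makes this map well defined, the other makes it injective, and surjectivity is
  automatic. This form removes \<open>f\<close> from all later arguments.\<close>

lemma Cs_iff:
  "\<psi> \<in> Cs X d \<longleftrightarrow> \<psi> \<in> Bij X \<and>
     (\<forall>x\<in>X. \<forall>y\<in>X. \<forall>u\<in>X. \<forall>v\<in>X. d x y = d u v \<longleftrightarrow> d (\<psi> x) (\<psi> y) = d (\<psi> u) (\<psi> v))"
  (is "_ \<longleftrightarrow> _ \<and> ?E")
proof
  assume "\<psi> \<in> Cs X d"
  then obtain f where B: "\<psi> \<in> Bij X" and f: "bij_betw f (distance_set X d) (distance_set X d)"
    and e: "\<And>x y. x \<in> X \<Longrightarrow> y \<in> X \<Longrightarrow> d x y = f (d (\<psi> x) (\<psi> y))"
    by (auto simp: Cs_def)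
  have D: "d (\<psi> x) (\<psi> y) \<in> distance_set X d" if "x \<in> X" "y \<in> X" for x y
    using that Bij_mem[OF B] by (auto simp: distance_set_def)
  have ?E
  proof (intro ballI)
    fix x y u v assume "x \<in> X" "y \<in> X" "u \<in> X" "v \<in> X"
    then show "d x y = d u v \<longleftrightarrow> d (\<psi> x) (\<psi> y) = d (\<psi> u) (\<psi> v)"
      using e[of x y] e[of u v] inj_on_eq_iff[OF bij_betw_imp_inj_on[OF f] D[of x y] D[of u v]]
      by simp
  qed
  with B show "\<psi> \<in> Bij X \<and> ?E" by blast
next
  assume a: "\<psi> \<in> Bij X \<and> ?E"
  then have B: "\<psi> \<in> Bij X" and E: "\<And>x y u v. \<lbrakk>x \<in> X; y \<in> X; u \<in> X; v \<in> X\<rbrakk> \<Longrightarrow>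
    d x y = d u v \<longleftrightarrow> d (\<psi> x) (\<psi> y) = d (\<psi> u) (\<psi> v)" by blast+
  define f where "f r = (SOME s. \<exists>x\<in>X. \<exists>y\<in>X. r = d (\<psi> x) (\<psi> y) \<and> s = d x y)" for r
  have f: "f (d (\<psi> x) (\<psi> y)) = d x y" if "x \<in> X" "y \<in> X" for x y
    unfolding f_def
  proof (rule some_equality)
    show "\<exists>x'\<in>X. \<exists>y'\<in>X. d (\<psi> x) (\<psi> y) = d (\<psi> x') (\<psi> y') \<and> d x y = d x' y'"
      using that by blast
    fix s assume "\<exists>x'\<in>X. \<exists>y'\<in>X. d (\<psi> x) (\<psi> y) = d (\<psi> x') (\<psi> y') \<and> s = d x' y'"
    then obtain x' y' where "x' \<in> X" "y' \<in> X" "d (\<psi> x) (\<psi> y) = d (\<psi> x') (\<psi> y')" "s = d x' y'"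
      by blast
    then show "s = d x y" using E[OF that, of x' y'] by simp
  qed
  \<comment> \<open>As \<open>\<psi>\<close> is onto, every distance is realised by a pair of
    images, so the formula for \<open>f\<close> covers the whole distance set.\<close>
  have D: "distance_set X d = {d (\<psi> x) (\<psi> y) | x y. x \<in> X \<and> y \<in> X}"
  proof -
    have "distance_set (\<psi> ` X) d = {d (\<psi> x) (\<psi> y) | x y. x \<in> X \<and> y \<in> X}"
      unfolding distance_set_def by blast
    then show ?thesis unfolding bij_betw_imp_surj_on[OF Bij_bij_betw[OF B]] .
  qed
  have "inj_on f (distance_set X d)"
    unfolding D using f E by (auto simp: inj_on_def)
  moreover have "f ` distance_set X d = distance_set X d"
  proof -
    have "f ` distance_set X d = {f (d (\<psi> x) (\<psi> y)) | x y. x \<in> X \<and> y \<in> X}"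
      unfolding D by blast
    also have "\<dots> = distance_set X d"
      unfolding distance_set_def using f by (intro Collect_cong) metis
    finally show ?thesis .
  qed
  ultimately have "bij_betw f (distance_set X d) (distance_set X d)"
    by (simp add: bij_betw_def)
  with B f show "\<psi> \<in> Cs X d" unfolding Cs_def by (auto intro!: exI[of _ f])
qed

text \<open>One implication of \<open>Cs_iff\<close> suffices if it is known for all permutations:
  the converse for \<open>\<psi>\<close> is the same implication for the inverse of
  \<open>\<psi>\<close>.\<close>

lemma Cs_eq_BijI:
  assumes P: "\<And>\<psi> x y u v. \<lbrakk>\<psi> \<in> Bij X; x \<in> X; y \<in> X; u \<in> X; v \<in> X; d x y = d u v\<rbrakk>
    \<Longrightarrow> d (\<psi> x) (\<psi> y) = d (\<psi> u) (\<psi> v)"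
  shows "Cs X d = Bij X"
proof
  show "Cs X d \<subseteq> Bij X" by (auto simp: Cs_def)
  show "Bij X \<subseteq> Cs X d"
  proof
    fix \<psi> assume B: "\<psi> \<in> Bij X"
    let ?g = "restrict (inv_into X \<psi>) X"
    have g: "?g \<in> Bij X" by (rule restrict_inv_into_Bij[OF B])
    have gi: "?g (\<psi> x) = x" if "x \<in> X" for x
      using that Bij_mem[OF B that] bij_betw_inv_into_left[OF Bij_bij_betw[OF B] that] by simp
    have "d x y = d u v" if m: "x \<in> X" "y \<in> X" "u \<in> X" "v \<in> X"
      and e: "d (\<psi> x) (\<psi> y) = d (\<psi> u) (\<psi> v)" for x y u v
      using P[OF g _ _ _ _ e] m Bij_mem[OF B] gi by metis
    with B P show "\<psi> \<in> Cs X d" unfolding Cs_iff by blast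
  qed
qed

text \<open>This is multiple transitivity of the symmetric group. By induction on \<open>A\<close>:
  a permutation that is right on \<open>A\<close> is followed by the transposition of
  \<open>\<psi> a\<close> and \<open>f a\<close>, which corrects the value at
  \<open>a\<close>.\<close>

lemma extend_inj_to_Bij:
  assumes "finite A" "A \<subseteq> X" "f ` A \<subseteq> X" "inj_on f A"
  shows "\<exists>\<psi> \<in> Bij X. \<forall>a\<in>A. \<psi> a = f a"
  using assms
proof (induction A rule: finite_induct)
  case empty
  then show ?case using id_Bij by blast
next
  case (insert a A)
  then obtain \<psi> where B: "\<psi> \<in> Bij X" and e: "\<And>b. b \<in> A \<Longrightarrow> \<psi> b = f b" by auto
  have m: "\<psi> a \<in> X" "f a \<in> X" "a \<in> X" using insert.prems Bij_mem[OF B] by auto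
  let ?t = "transpose (\<psi> a) (f a)"
  have "bij_betw ?t X X"
    by (rule bij_betw_byWitness[where f' = ?t]) (use m in \<open>auto simp: transpose_def\<close>)
  then have t: "restrict ?t X \<in> Bij X"
    by (simp add: Bij_def bij_betw_restrict_eq)
  have "compose X (restrict ?t X) \<psi> b = f b" if b: "b \<in> insert a A" for b
  proof (cases "b = a")
    case True
    then show ?thesis using m by (simp add: compose_def)
  next
    case False
    with b insert.prems have bX: "b \<in> X" "b \<in> A" by auto
    \<comment> \<open>The value \<open>f b\<close> already attained at \<open>b\<close> differs from
      both points moved by the transposition, so it survives the correction.\<close>
    have "f b \<noteq> f a" using insert.prems(3) bX False by (auto simp: inj_on_def)
    moreover have "f b \<noteq> \<psi> a" using Bij_eq_iff[OF B bX(1) m(3)] e[OF bX(2)] False by simp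
    ultimately show ?thesis
      using bX Bij_mem[OF B bX(1)] e[OF bX(2)] by (simp add: compose_def)
  qed
  with compose_Bij[OF t B] show ?case by blast
qed

section \<open>Isometric invariance\<close>

text \<open>Two carriers of possibly different types are allowed, because a subset of
  \<open>X\<close> has to be compared with a set of blocks.\<close>

definition isometry_betw ::
  "('a \<Rightarrow> 'b) \<Rightarrow> 'a set \<Rightarrow> ('a \<Rightarrow> 'a \<Rightarrow> real) \<Rightarrow> 'b set \<Rightarrow> ('b \<Rightarrow> 'b \<Rightarrow> real) \<Rightarrow> bool" where
  "isometry_betw h Y d Z e \<longleftrightarrow> bij_betw h Y Z \<and> (\<forall>x\<in>Y. \<forall>y\<in>Y. e (h x) (h y) = d x y)"

lemma isometry_betw_inv_into:
  assumes "isometry_betw h Y d Z e"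
  shows "isometry_betw (inv_into Y h) Z e Y d"
proof -
  have h: "bij_betw h Y Z" "\<And>x y. x \<in> Y \<Longrightarrow> y \<in> Y \<Longrightarrow> e (h x) (h y) = d x y"
    using assms by (auto simp: isometry_betw_def)
  have g: "bij_betw (inv_into Y h) Z Y" by (rule bij_betw_inv_into[OF h(1)])
  have "d (inv_into Y h x) (inv_into Y h y) = e x y" if "x \<in> Z" "y \<in> Z" for x y
    using h(2)[of "inv_into Y h x" "inv_into Y h y"] bij_betwE[OF g] that
      bij_betw_inv_into_right[OF h(1)] by simp
  with g show ?thesis by (simp add: isometry_betw_def)
qed

lemma isometry_betw_trans:
  assumes "isometry_betw h Y d Z e" "isometry_betw k Z e W f"
  shows "isometry_betw (k \<circ> h) Y d W f"
  using assms bij_betw_trans[of h Y Z k W] bij_betwE[of h Y Z]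
  unfolding isometry_betw_def by auto

lemma isometry_betw_metric_on:
  assumes i: "isometry_betw h Y d Z e" and m: "metric_on Y d"
  shows "metric_on Z e"
proof -
  have Z: "Z = h ` Y" and e: "\<And>x y. x \<in> Y \<Longrightarrow> y \<in> Y \<Longrightarrow> e (h x) (h y) = d x y"
    using i by (auto simp: isometry_betw_def bij_betw_def)
  show ?thesis
    using m unfolding Z metric_on_def pseudometric_on_def by (simp add: e) blast
qed

lemma isometry_betw_strongly_rigid_metric:
  assumes i: "isometry_betw h Y d Z e" and m: "strongly_rigid_metric Y d"
  shows "strongly_rigid_metric Z e"
  unfolding strongly_rigid_metric_def
proof (intro conjI ballI impI)
  have Z: "Z = h ` Y" and e: "\<And>x y. x \<in> Y \<Longrightarrow> y \<in> Y \<Longrightarrow> e (h x) (h y) = d x y"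
    using i by (auto simp: isometry_betw_def bij_betw_def)
  show "metric_on Z e"
    using isometry_betw_metric_on[OF i] m by (simp add: strongly_rigid_metric_def)
  fix x y u v assume "x \<in> Z" "y \<in> Z" "u \<in> Z" "v \<in> Z" and q: "e x y = e u v \<and> e u v \<noteq> 0"
  then obtain x' y' u' v' where p: "x' \<in> Y" "y' \<in> Y" "u' \<in> Y" "v' \<in> Y"
    and h: "x = h x'" "y = h y'" "u = h u'" "v = h v'" unfolding Z by blast
  have "d x' y' = d u' v'" "d u' v' \<noteq> 0" using q e p unfolding h by auto
  then have "{x', y'} = {u', v'}" using m p unfolding strongly_rigid_metric_def by blast
  then have "h ` {x', y'} = h ` {u', v'}" by (rule arg_cong)
  then show "{x, y} = {u, v}" by (simp add: h)
qed

lemma isometry_betw_distance_set: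
  assumes i: "isometry_betw h Y d Z e"
  shows "distance_set Z e = distance_set Y d"
proof -
  have Z: "Z = h ` Y" and e: "\<And>x y. x \<in> Y \<Longrightarrow> y \<in> Y \<Longrightarrow> e (h x) (h y) = d x y"
    using i by (auto simp: isometry_betw_def bij_betw_def)
  have "distance_set Z e = {e (h x) (h y) | x y. x \<in> Y \<and> y \<in> Y}"
    unfolding Z distance_set_def by blast
  also have "\<dots> = distance_set Y d"
    unfolding distance_set_def using e by (intro Collect_cong) metis
  finally show ?thesis .
qed

lemma isometry_betw_discrete_metric:
  assumes "isometry_betw h Y d Z e" "discrete_metric Y d"
  shows "discrete_metric Z e"
  using assms isometry_betw_metric_on isometry_betw_distance_set
  unfolding discrete_metric_def by metis

lemma isometric_sets_iff: "isometric_sets d Y Z \<longleftrightarrow> (\<exists>h. isometry_betw h Y d Z d)"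
  by (simp add: isometric_sets_def isometry_betw_def)

lemma isometric_sets_distance_set:
  "isometric_sets d Y Z \<Longrightarrow> distance_set Y d = distance_set Z d"
  unfolding isometric_sets_iff using isometry_betw_distance_set by metis

text \<open>An isometry from \<open>Y\<close> to \<open>Z\<close> is conjugated by \<open>h\<close>
  and \<open>k\<close>: go back along \<open>h\<close>, across to \<open>Z\<close>, then along
  \<open>k\<close>.\<close>

lemma isometry_betw_isometric_sets:
  assumes "isometry_betw h Y d Y' e" "isometry_betw k Z d Z' e" "isometric_sets d Y Z"
  shows "isometric_sets e Y' Z'"
proof -
  obtain g where "isometry_betw g Y d Z d" using assms(3) unfolding isometric_sets_iff by blast
  from isometry_betw_trans[OF isometry_betw_trans[OF isometry_betw_inv_into[OF assms(1)] this] assms(2)]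
  show ?thesis unfolding isometric_sets_iff by blast
qed

section \<open>Metric spaces all of whose permutations are self-similarities\<close>

context
  fixes M :: "'b set" and d :: "'b \<Rightarrow> 'b \<Rightarrow> real"
  assumes met: "metric_on M d"
begin

text \<open>A nonzero distance determines its unordered pair, so equal distances come from the same
  pair or from two degenerate pairs; both situations persist under any permutation.\<close>

lemma Cs_eq_Bij_if_strongly_rigid:
  assumes "strongly_rigid_metric M d"
  shows "Cs M d = Bij M"
proof (rule Cs_eq_BijI)
  fix \<psi> x y u v assume B: "\<psi> \<in> Bij M" and m: "x \<in> M" "y \<in> M" "u \<in> M" "v \<in> M"
    and e: "d x y = d u v"
  show "d (\<psi> x) (\<psi> y) = d (\<psi> u) (\<psi> v)"
  proof (cases "d u v = 0")
    case True
    then have "x = y" "u = v" using e metric_onD(3)[OF met m(1,2)] metric_onD(3)[OF met m(3,4)]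
      by simp_all
    then show ?thesis using m Bij_mem[OF B] metric_onD(3)[OF met] by metis
  next
    case False
    then have "{x, y} = {u, v}" using assms e m unfolding strongly_rigid_metric_def by blast
    then show ?thesis using m Bij_mem[OF B] metric_onD(2)[OF met] by (metis doubleton_eq_iff)
  qed
qed

text \<open>There is at most one positive distance, and a permutation keeps distinct points
  distinct.\<close>

lemma Cs_eq_Bij_if_discrete:
  assumes "discrete_metric M d"
  shows "Cs M d = Bij M"
proof (rule Cs_eq_BijI)
  fix \<psi> x y u v assume B: "\<psi> \<in> Bij M" and m: "x \<in> M" "y \<in> M" "u \<in> M" "v \<in> M"
    and e: "d x y = d u v"
  have c: "finite (distance_set M d)" "card (distance_set M d) \<le> 2"
    using assms by (auto simp: discrete_metric_def)
  note p = Bij_mem[OF B m(1)] Bij_mem[OF B m(2)] Bij_mem[OF B m(3)] Bij_mem[OF B m(4)]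
  show "d (\<psi> x) (\<psi> y) = d (\<psi> u) (\<psi> v)"
  proof (rule ccontr)
    assume n: "\<not> ?thesis"
    have xy: "x \<noteq> y \<and> u \<noteq> v" using n e m p metric_onD(3)[OF met] by metis
    have "\<psi> x \<noteq> \<psi> y" "\<psi> u \<noteq> \<psi> v" using xy Bij_eq_iff[OF B] m by auto
    \<comment> \<open>Two different positive distances together with 0 exceed the bound of two
      values.\<close>
    then have "card {0, d (\<psi> x) (\<psi> y), d (\<psi> u) (\<psi> v)} = 3"
      using n p metric_onD(3)[OF met] by auto
    moreover have "d x x = 0" using metric_onD(3)[OF met] m by auto
    then have "{0, d (\<psi> x) (\<psi> y), d (\<psi> u) (\<psi> v)} \<subseteq> distance_set M d"
      using p m unfolding distance_set_def by force
    from card_mono[OF c(1) this] have "card {0, d (\<psi> x) (\<psi> y), d (\<psi> u) (\<psi> v)} \<le> 2"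
      using c(2) by (rule order_trans)
    ultimately show False by simp
  qed
qed

lemma distance_set_triple:
  assumes "a \<in> M" "b \<in> M" "c \<in> M"
  shows "distance_set {a, b, c} d = {0, d a b, d a c, d b c}"
proof -
  have "d a a = 0" "d b b = 0" "d c c = 0" "d b a = d a b" "d c a = d a c" "d c b = d b c"
    using assms metric_onD(2,3)[OF met] by auto
  moreover have "distance_set {a, b, c} d =
      {d a a, d b b, d c c, d b a, d c a, d c b, d a b, d a c, d b c}"
    unfolding distance_set_def by blast
  ultimately show ?thesis by auto
qed

text \<open>Isometric triples have the same distances, so \<open>d a b\<close> occurs in the triple
  \<open>{a, c, e}\<close>. Rigidity of the triples \<open>{a, b, c}\<close> and
  \<open>{a, b, e}\<close> excludes the edges at \<open>a\<close>, which leaves only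
  \<open>d c e\<close>.\<close>

lemma pseudorectangle_opposite:
  assumes R: "pseudorectangle M d"
    and m: "a \<in> M" "b \<in> M" "c \<in> M" "e \<in> M" and "distinct [a, b, c, e]"
  shows "d a b = d c e"
proof -
  have T: "metric_subspace {x, y, z} M d \<and> card {x, y, z} = 3"
    if "x \<in> M" "y \<in> M" "z \<in> M" "x \<noteq> y" "x \<noteq> z" "y \<noteq> z" for x y z
    using that metric_on_subset[OF met, of "{x, y, z}"] by (simp add: metric_subspace_def)
  have I: "distance_set {a, b, c} d = distance_set {x, y, z} d"
    if "x \<in> M" "y \<in> M" "z \<in> M" "x \<noteq> y" "x \<noteq> z" "y \<noteq> z" for x y z
  proof (rule isometric_sets_distance_set)
    have "metric_subspace {a, b, c} M d \<and> card {a, b, c} = 3" by (rule T) (use m assms(6) in auto)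
    with R T[OF that] show "isometric_sets d {a, b, c} {x, y, z}"
      unfolding pseudorectangle_def by blast
  qed
  have S: "d x y \<noteq> d x z"
    if "x \<in> M" "y \<in> M" "z \<in> M" "x \<noteq> y" "x \<noteq> z" "y \<noteq> z" for x y z
  proof
    assume "d x y = d x z"
    moreover have "d x z \<noteq> 0" using that metric_onD(3)[OF met] by blast
    moreover have "strongly_rigid_metric {x, y, z} d"
      using R T[OF that] unfolding pseudorectangle_def by blast
    ultimately have "{x, y} = {x, z}" unfolding strongly_rigid_metric_def by blast
    with that show False by (auto simp: doubleton_eq_iff)
  qed
  have "d a b \<in> distance_set {a, b, c} d" by (auto simp: distance_set_def)
  also have "\<dots> = distance_set {a, c, e} d" using I[of a c e] m assms(6) by simp
  also have "\<dots> = {0, d a c, d a e, d c e}" by (rule distance_set_triple[OF m(1,3,4)])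
  finally have "d a b \<in> {0, d a c, d a e, d c e}" .
  moreover have "d a b \<noteq> 0" using metric_onD(3)[OF met m(1,2)] assms(6) by simp
  moreover have "d a b \<noteq> d a c" "d a b \<noteq> d a e"
    using S[of a b c] S[of a b e] m assms(6) by auto
  ultimately show ?thesis by simp
qed

text \<open>Disjoint edges stay disjoint under a permutation, and disjoint edges always have equal
  length. Distinct edges that meet span a triple, whose rigidity forbids equal lengths.\<close>

lemma Cs_eq_Bij_if_pseudorectangle:
  assumes R: "pseudorectangle M d"
  shows "Cs M d = Bij M"
proof (rule Cs_eq_BijI)
  fix \<psi> x y u v assume B: "\<psi> \<in> Bij M" and m: "x \<in> M" "y \<in> M" "u \<in> M" "v \<in> M"
    and e: "d x y = d u v"
  note p = Bij_mem[OF B m(1)] Bij_mem[OF B m(2)] Bij_mem[OF B m(3)] Bij_mem[OF B m(4)]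
  show "d (\<psi> x) (\<psi> y) = d (\<psi> u) (\<psi> v)"
  proof (cases "x = y \<or> u = v")
    case True
    then show ?thesis using e m p metric_onD(3)[OF met] by metis
  next
    case False
    show ?thesis
    proof (cases "{x, y} \<inter> {u, v} = {}")
      case True
      with False have "distinct [\<psi> x, \<psi> y, \<psi> u, \<psi> v]" using Bij_eq_iff[OF B] m by auto
      with pseudorectangle_opposite[OF R] p show ?thesis by blast
    next
      case nd: False
      have "{x, y} = {u, v}"
      proof (rule ccontr)
        assume n: "{x, y} \<noteq> {u, v}"
        have "card {x, y, u, v} = 3" using n nd False by (auto simp: card_insert_if)
        then have "strongly_rigid_metric {x, y, u, v} d"
          using R m metric_on_subset[OF met, of "{x, y, u, v}"]
          by (simp add: pseudorectangle_def metric_subspace_def)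
        moreover have "d u v \<noteq> 0" using False metric_onD(3)[OF met m(3,4)] by simp
        ultimately show False using n e by (simp add: strongly_rigid_metric_def)
      qed
      then show ?thesis using p metric_onD(2)[OF met] by (metis doubleton_eq_iff)
    qed
  qed
qed

text \<open>Some permutation carries \<open>x, y, z\<close> to any given triple of distinct points,
  so any two edges with a common endpoint are equally long; any two edges are then linked through
  such pairs.\<close>

lemma Cs_eq_Bij_imp_discrete:
  assumes C: "Cs M d = Bij M" and m: "x \<in> M" "y \<in> M" "z \<in> M" and n: "distinct [x, y, z]"
    and e: "d x y = d x z"
  shows "discrete_metric M d"
proof -
  note s = metric_onD(2)[OF met] and z = metric_onD(3)[OF met]
  have adj: "d a b = d a c" if t: "a \<in> M" "b \<in> M" "c \<in> M" "distinct [a, b, c]" for a b c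
  proof -
    let ?f = "id(x := a, y := b, z := c)"
    have "\<exists>\<psi>\<in>Bij M. \<forall>t\<in>{x, y, z}. \<psi> t = ?f t"
      by (rule extend_inj_to_Bij) (use m n t in \<open>auto simp: inj_on_def\<close>)
    then obtain \<psi> where "\<psi> \<in> Cs M d" "\<psi> x = a" "\<psi> y = b" "\<psi> z = c" using n C by auto
    then show ?thesis using m e unfolding Cs_iff by metis
  qed
  \<comment> \<open>The edge from \<open>a\<close> to \<open>v\<close> meets both given edges. If it
    degenerates, these already share the point \<open>a = v\<close>.\<close>
  have eq: "d a b = d u v" if t: "a \<in> M" "b \<in> M" "u \<in> M" "v \<in> M" "a \<noteq> b" "u \<noteq> v" for a b u v
  proof (cases "v = a")
    case True
    then show ?thesis using t adj[of a b u] s[of u v] by (cases "b = u") auto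
  next
    case False
    have "d a b = d a v" using t False adj[of a b v] by (cases "b = v") auto
    also have "\<dots> = d u v" using t False adj[of v a u] s by (cases "a = u") auto
    finally show ?thesis .
  qed
  have "d a b \<in> {0, d x y}" if "a \<in> M" "b \<in> M" for a b
    using eq[OF that m(1,2)] z[OF that] n by auto
  then have sub: "distance_set M d \<subseteq> {0, d x y}" unfolding distance_set_def by blast
  have "finite (distance_set M d)" "card (distance_set M d) \<le> card {0, d x y}"
    by (rule finite_subset[OF sub] card_mono[OF _ sub]; simp)+
  moreover have "card {0, d x y} \<le> 2" by (simp add: card_insert_if)
  ultimately show ?thesis using met by (simp add: discrete_metric_def)
qed

text \<open>Transitivity on quadruples makes all pairs of disjoint edges equally long, while
  non-discreteness makes edges with a common endpoint differ. Together these limit \<open>M\<close>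
  to four points and determine which distances agree.\<close>

lemma Cs_eq_Bij_imp_pseudorectangle:
  assumes C: "Cs M d = Bij M" and nd: "\<not> discrete_metric M d"
    and m: "x \<in> M" "y \<in> M" "u \<in> M" "v \<in> M" and n: "distinct [x, y, u, v]"
    and e: "d x y = d u v"
  shows "pseudorectangle M d"
proof -
  note s = metric_onD(2)[OF met] and z = metric_onD(3)[OF met]
  have opp: "d a b = d c f" if t: "a \<in> M" "b \<in> M" "c \<in> M" "f \<in> M" "distinct [a, b, c, f]"
    for a b c f
  proof -
    let ?f = "id(x := a, y := b, u := c, v := f)"
    have "\<exists>\<psi>\<in>Bij M. \<forall>t\<in>{x, y, u, v}. \<psi> t = ?f t"
      by (rule extend_inj_to_Bij) (use m n t in \<open>auto simp: inj_on_def\<close>)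
    then obtain \<psi> where "\<psi> \<in> Cs M d" "\<psi> x = a" "\<psi> y = b" "\<psi> u = c" "\<psi> v = f" using n C by auto
    then show ?thesis using m e unfolding Cs_iff by metis
  qed
  have adj: "d a b \<noteq> d a c" if "a \<in> M" "b \<in> M" "c \<in> M" "distinct [a, b, c]" for a b c
    using Cs_eq_Bij_imp_discrete[OF C that] nd by blast
  have M: "M = {x, y, u, v}"
  proof (rule ccontr)
    assume "\<not> ?thesis"
    then obtain w where w: "w \<in> M" "w \<notin> {x, y, u, v}" using m by blast
    \<comment> \<open>With a fifth point \<open>w\<close>, both \<open>u v\<close> and
      \<open>u w\<close> are disjoint from \<open>x y\<close>, so two edges at \<open>u\<close> get
      equal lengths.\<close>
    then have "d u v = d u w" using opp[of x y u w] e m n by auto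
    then show False using adj[of u v w] w m n by auto
  qed
  have cM: "card M = 4" "finite M" using n by (auto simp: M)
  have R: "strongly_rigid_metric Y d" if Y: "metric_subspace Y M d" "card Y = 3" for Y
    unfolding strongly_rigid_metric_def
  proof (intro conjI ballI impI)
    show "metric_on Y d" using Y(1) by (simp add: metric_subspace_def)
    fix a b c f assume t: "a \<in> Y" "b \<in> Y" "c \<in> Y" "f \<in> Y" and q: "d a b = d c f \<and> d c f \<noteq> 0"
    have tM: "a \<in> M" "b \<in> M" "c \<in> M" "f \<in> M" using t Y(1) by (auto simp: metric_subspace_def)
    have ne: "a \<noteq> b" "c \<noteq> f" using q z tM by metis+
    show "{a, b} = {c, f}"
    proof (rule ccontr)
      assume ns: "{a, b} \<noteq> {c, f}"
      \<comment> \<open>Three points leave no room for disjoint edges, so the two edges meet and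
        \<open>adj\<close> applies.\<close>
      have "\<not> distinct [a, b, c, f]"
      proof
        assume "distinct [a, b, c, f]"
        then have "card {a, b, c, f} = 4" by simp
        moreover have "card {a, b, c, f} \<le> card Y"
          using t Y(2) by (intro card_mono) (auto intro: card_ge_0_finite)
        ultimately show False using Y(2) by simp
      qed
      then consider "a = c" "b \<noteq> f" | "a = f" "b \<noteq> c" | "b = c" "a \<noteq> f" | "b = f" "a \<noteq> c"
        using ne ns by auto
      then show False
        using q tM ne adj[of a b f] adj[of a b c] adj[of b a f] adj[of b a c]
          s[of a b] s[of c f] by cases auto
    qed
  qed
  have I: "isometric_sets d Y Z"
    if Y: "metric_subspace Y M d" "card Y = 3" and Z: "metric_subspace Z M d" "card Z = 3" for Y Z
  proof (cases "Y = Z")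
    case True
    then show ?thesis unfolding isometric_sets_def by (intro exI[of _ id]) auto
  next
    case False
    have miss: "\<exists>a\<in>M. W = M - {a}" if "W \<subseteq> M" "card W = 3" for W
    proof -
      have "card (M - W) = 1" using that cM by (simp add: card_Diff_subset finite_subset)
      then obtain a where "M - W = {a}" by (auto simp: card_1_singleton_iff)
      then show ?thesis using that(1) by blast
    qed
    obtain a b where a: "a \<in> M" "Y = M - {a}" and b: "b \<in> M" "Z = M - {b}"
      using miss Y Z unfolding metric_subspace_def by meson
    have ab: "a \<noteq> b" using False a b by auto
    \<comment> \<open>The triples omit one point each, \<open>a\<close> and \<open>b\<close>, and
      share the other two, \<open>p\<close> and \<open>q\<close>.\<close>
    have "card (M - {a, b}) = 2" using cM a b ab by (simp add: card_Diff_subset)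
    then obtain p q where pq: "M - {a, b} = {p, q}" "p \<noteq> q" by (auto simp: card_2_iff)
    have pM: "p \<in> M" "q \<in> M" and pn: "p \<notin> {a, b}" "q \<notin> {a, b}" using pq by blast+
    have Y': "Y = {b, p, q}" and Z': "Z = {a, q, p}" using pq a b ab by blast+
    \<comment> \<open>Besides sending \<open>b\<close> to \<open>a\<close>, the map must swap
      \<open>p\<close> and \<open>q\<close>: the edge opposite to \<open>b p\<close> is
      \<open>a q\<close>, not \<open>a p\<close>.\<close>
    let ?h = "id(b := a, p := q, q := p)"
    have "bij_betw ?h Y Z"
      unfolding Y' Z' bij_betw_def using pn ab pq(2) by (auto simp: inj_on_def)
    moreover have "d b p = d a q" "d b q = d a p" "d p q = d q p"
      using opp[of b p a q] opp[of b q a p] s a b pM pn ab pq(2) by auto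
    then have "d (?h t) (?h w) = d t w" if "t \<in> Y" "w \<in> Y" for t w
      using that pn ab pq(2) a(1) b(1) pM z[of a a] z[of b b] z[of p p] z[of q q]
        s[of p b] s[of q b] s[of p a] s[of q a]
      unfolding Y' by auto
    ultimately show ?thesis unfolding isometric_sets_def by blast
  qed
  have "metric_subspace M M d \<and> card M = 4 \<and> (\<forall>x\<in>M. \<exists>y\<in>M. d x y = 0)"
    using met cM z by (auto simp: metric_subspace_def)
  with R I show ?thesis unfolding pseudorectangle_def by blast
qed

lemma Cs_eq_Bij_iff:
  "Cs M d = Bij M \<longleftrightarrow> strongly_rigid_metric M d \<or> discrete_metric M d \<or> pseudorectangle M d"
proof
  assume C: "Cs M d = Bij M"
  show "strongly_rigid_metric M d \<or> discrete_metric M d \<or> pseudorectangle M d"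
  proof (cases "strongly_rigid_metric M d")
    case False
    then obtain x y u v where m: "x \<in> M" "y \<in> M" "u \<in> M" "v \<in> M"
      and e: "d x y = d u v" "d u v \<noteq> 0" and n: "{x, y} \<noteq> {u, v}"
      using met unfolding strongly_rigid_metric_def by blast
    note s = metric_onD(2)[OF met]
    have ne: "x \<noteq> y" "u \<noteq> v" using e m metric_onD(3)[OF met] by metis+
    \<comment> \<open>Two different nondegenerate pairs are disjoint or share exactly one point, in
      one of four positions. The disjoint case gives a pseudorectangle unless \<open>M\<close> is
      discrete; the others give discreteness.\<close>
    consider "distinct [x, y, u, v]" | "x = u" "y \<noteq> v" | "x = v" "y \<noteq> u"
      | "y = u" "x \<noteq> v" | "y = v" "x \<noteq> u" using ne n by auto
    then show ?thesis
    proof cases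
      case 1
      then show ?thesis using Cs_eq_Bij_imp_pseudorectangle[OF C _ m _ e(1)] by blast
    next
      case 2
      then show ?thesis using Cs_eq_Bij_imp_discrete[OF C, of x y v] m ne e by auto
    next
      case 3
      then show ?thesis using Cs_eq_Bij_imp_discrete[OF C, of x y u] m ne e s[of u v] by auto
    next
      case 4
      then show ?thesis using Cs_eq_Bij_imp_discrete[OF C, of y x v] m ne e s[of x y] by auto
    next
      case 5
      then show ?thesis
        using Cs_eq_Bij_imp_discrete[OF C, of y x u] m ne e s[of x y] s[of u v] by auto
    qed
  qed blast
qed (use Cs_eq_Bij_if_strongly_rigid Cs_eq_Bij_if_discrete Cs_eq_Bij_if_pseudorectangle in blast)

text \<open>A metric space is one of its own metric subspaces, and the property passes to subsets.
  The same reasoning settles discreteness next.\<close>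

lemma strongly_rigid_iff_metric: "strongly_rigid M d \<longleftrightarrow> strongly_rigid_metric M d"
proof
  assume "strongly_rigid M d"
  then show "strongly_rigid_metric M d"
    using met unfolding strongly_rigid_def metric_subspace_def by blast
next
  assume "strongly_rigid_metric M d"
  then show "strongly_rigid M d"
    unfolding strongly_rigid_def strongly_rigid_metric_def metric_subspace_def subset_iff by simp
qed

lemma discrete_pseudometric_iff_metric: "discrete_pseudometric M d \<longleftrightarrow> discrete_metric M d"
proof
  assume "discrete_pseudometric M d"
  then show "discrete_metric M d"
    using met unfolding discrete_pseudometric_def metric_subspace_def by blast
next
  assume D: "discrete_metric M d"
  show "discrete_pseudometric M d"
    unfolding discrete_pseudometric_def
  proof (intro allI impI)
    fix Y assume Y: "metric_subspace Y M d"
    then have sub: "distance_set Y d \<subseteq> distance_set M d"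
      unfolding distance_set_def metric_subspace_def by blast
    have "finite (distance_set M d)" "card (distance_set M d) \<le> 2"
      using D by (auto simp: discrete_metric_def)
    then show "discrete_metric Y d"
      using Y finite_subset[OF sub] card_mono[OF _ sub]
      by (simp add: discrete_metric_def metric_subspace_def)
  qed
qed

end

section \<open>The metric reflection\<close>

text \<open>Every quantifier over metric subspaces is made universal, the existential one by double
  negation, so that \<open>all_metric_subspace_reflection\<close> can rewrite each clause.\<close>

lemma pseudorectangle_iff:
  "pseudorectangle X d \<longleftrightarrow>
     (\<forall>Y. metric_subspace Y X d \<longrightarrow> card Y = 3 \<longrightarrow> strongly_rigid_metric Y d) \<and>
     (\<forall>Y. metric_subspace Y X d \<longrightarrow> (\<forall>Z. metric_subspace Z X d \<longrightarrow>
        card Y = 3 \<longrightarrow> card Z = 3 \<longrightarrow> isometric_sets d Y Z)) \<and>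
     \<not> (\<forall>Y. metric_subspace Y X d \<longrightarrow> \<not> (card Y = 4 \<and> (\<forall>x\<in>X. \<exists>y\<in>Y. d x y = 0)))"
  unfolding pseudorectangle_def
  by (intro arg_cong2[where f = conj]) blast+

context
  fixes X :: "'a set" and d :: "'a \<Rightarrow> 'a \<Rightarrow> real"
  assumes P: "pseudometric_on X d"
begin

abbreviation blocks :: "'a set set" where
  "blocks \<equiv> X // zero_dist_rel X d"

abbreviation block :: "'a \<Rightarrow> 'a set" where
  "block x \<equiv> zero_dist_rel X d `` {x}"

lemma block_mem: "x \<in> X \<Longrightarrow> block x \<in> blocks"
  by (rule quotientI)

lemma block_self: "x \<in> X \<Longrightarrow> x \<in> block x"
  by (rule equiv_class_self[OF equiv_zero_dist_rel[OF P]])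

lemma block_eq:
  assumes "A \<in> blocks" "x \<in> A"
  shows "x \<in> X \<and> block x = A"
proof -
  note E = equiv_zero_dist_rel[OF P]
  have x: "x \<in> X" using in_quotient_imp_subset[OF E assms(1)] assms(2) by blast
  have "block x = A \<longleftrightarrow> (x, x) \<in> zero_dist_rel X d"
    by (rule quotient_eq_iff[OF E block_mem[OF x] assms(1) block_self[OF x] assms(2)])
  then show ?thesis using x block_self[OF x] by simp
qed

lemma reflection_dist_block: "x \<in> X \<Longrightarrow> y \<in> X \<Longrightarrow> reflection_dist d (block x) (block y) = d x y"
  by (rule reflection_dist_eq[OF P block_mem block_mem block_self block_self])

lemma block_eq_iff:
  assumes "x \<in> X" "y \<in> X"
  shows "block x = block y \<longleftrightarrow> d x y = 0"
proof -
  have "block x = block y \<longleftrightarrow> (x, y) \<in> zero_dist_rel X d"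
    by (rule eq_equiv_class_iff[OF equiv_zero_dist_rel[OF P] assms])
  also have "\<dots> \<longleftrightarrow> d x y = 0" using assms by (simp add: zero_dist_rel_def)
  finally show ?thesis .
qed

text \<open>Distinct points of a metric subspace have nonzero distance and so lie in different
  blocks; hence \<open>block\<close> is injective there, and it preserves distances.\<close>

lemma metric_subspace_to_reflection:
  assumes "metric_subspace Y X d"
  shows "metric_subspace (block ` Y) blocks (reflection_dist d)"
    and "isometry_betw block Y d (block ` Y) (reflection_dist d)"
proof -
  have Y: "Y \<subseteq> X" "metric_on Y d" using assms by (auto simp: metric_subspace_def)
  have "inj_on block Y"
    using Y block_eq_iff metric_onD(3)[OF Y(2)] by (meson inj_onI subsetD)
  then show i: "isometry_betw block Y d (block ` Y) (reflection_dist d)"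
    using Y reflection_dist_block by (auto simp: isometry_betw_def bij_betw_def subset_iff)
  show "metric_subspace (block ` Y) blocks (reflection_dist d)"
    using isometry_betw_metric_on[OF i Y(2)] Y(1) block_mem by (auto simp: metric_subspace_def)
qed

text \<open>Choosing a representative of each block in \<open>Z\<close> yields an isometric copy of
  \<open>Z\<close> inside \<open>X\<close>.\<close>

lemma metric_subspace_from_reflection:
  assumes "metric_subspace Z blocks (reflection_dist d)"
  obtains Y where "metric_subspace Y X d" "Z = block ` Y"
proof -
  have Z: "Z \<subseteq> blocks" using assms by (auto simp: metric_subspace_def)
  define r where "r A = (SOME x. x \<in> A)" for A :: "'a set"
  have r: "r A \<in> X \<and> block (r A) = A" if "A \<in> Z" for A
  proof -
    have A: "A \<in> blocks" using that Z by blast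
    then have "\<exists>x. x \<in> A" using in_quotient_imp_non_empty[OF equiv_zero_dist_rel[OF P]] by blast
    then have "r A \<in> A" unfolding r_def by (rule someI_ex)
    with A show ?thesis by (rule block_eq)
  qed
  have "inj_on r Z" by (rule inj_on_inverseI[of _ block]) (use r in blast)
  moreover have "d (r A) (r A') = reflection_dist d A A'" if "A \<in> Z" "A' \<in> Z" for A A'
    using r[OF that(1)] r[OF that(2)] reflection_dist_block[of "r A" "r A'"] by simp
  ultimately have "isometry_betw r Z (reflection_dist d) (r ` Z) d"
    by (simp add: isometry_betw_def bij_betw_def)
  from isometry_betw_metric_on[OF this] have "metric_subspace (r ` Z) X d"
    using assms r by (auto simp: metric_subspace_def)
  moreover have "Z = block ` (r ` Z)" using r by force
  ultimately show ?thesis by (rule that)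
qed

text \<open>The metric subspaces of the reflection are exactly the images of those of
  \<open>X\<close>. This transfer principle carries all three geometric conditions to the
  reflection.\<close>

lemma all_metric_subspace_reflection:
  assumes 1: "\<And>Y. metric_subspace Y X d \<Longrightarrow> Q Y \<longleftrightarrow> R (block ` Y)"
  shows "(\<forall>Y. metric_subspace Y X d \<longrightarrow> Q Y) \<longleftrightarrow>
    (\<forall>Z. metric_subspace Z blocks (reflection_dist d) \<longrightarrow> R Z)"
  using 1 metric_subspace_to_reflection(1) metric_subspace_from_reflection by metis

lemma strongly_rigid_metric_block:
  assumes "metric_subspace Y X d"
  shows "strongly_rigid_metric Y d \<longleftrightarrow> strongly_rigid_metric (block ` Y) (reflection_dist d)"
proof -
  note i = metric_subspace_to_reflection(2)[OF assms]
  show ?thesis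
    using isometry_betw_strongly_rigid_metric[OF i]
      isometry_betw_strongly_rigid_metric[OF isometry_betw_inv_into[OF i]] by blast
qed

lemma discrete_metric_block:
  assumes "metric_subspace Y X d"
  shows "discrete_metric Y d \<longleftrightarrow> discrete_metric (block ` Y) (reflection_dist d)"
proof -
  note i = metric_subspace_to_reflection(2)[OF assms]
  show ?thesis
    using isometry_betw_discrete_metric[OF i]
      isometry_betw_discrete_metric[OF isometry_betw_inv_into[OF i]] by blast
qed

lemma isometric_sets_block:
  assumes "metric_subspace Y X d" "metric_subspace Z X d"
  shows "isometric_sets d Y Z \<longleftrightarrow> isometric_sets (reflection_dist d) (block ` Y) (block ` Z)"
proof -
  note i = metric_subspace_to_reflection(2)[OF assms(1)]
    and k = metric_subspace_to_reflection(2)[OF assms(2)]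
  show ?thesis
    using isometry_betw_isometric_sets[OF i k]
      isometry_betw_isometric_sets[OF isometry_betw_inv_into[OF i] isometry_betw_inv_into[OF k]]
    by blast
qed

lemma strongly_rigid_reflection:
  "strongly_rigid X d \<longleftrightarrow> strongly_rigid blocks (reflection_dist d)"
  unfolding strongly_rigid_def
  by (rule all_metric_subspace_reflection) (rule strongly_rigid_metric_block)

lemma discrete_reflection:
  "discrete_pseudometric X d \<longleftrightarrow> discrete_pseudometric blocks (reflection_dist d)"
  unfolding discrete_pseudometric_def
  by (rule all_metric_subspace_reflection) (rule discrete_metric_block)

lemma card_block_image: "metric_subspace Y X d \<Longrightarrow> card (block ` Y) = card Y"
  using metric_subspace_to_reflection(2) bij_betw_same_card unfolding isometry_betw_def by metis

lemma pseudorectangle_reflection: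
  "pseudorectangle X d \<longleftrightarrow> pseudorectangle blocks (reflection_dist d)"
proof -
  let ?e = "reflection_dist d"
  have dense: "(\<forall>x\<in>X. \<exists>y\<in>Y. d x y = 0) \<longleftrightarrow> (\<forall>A\<in>blocks. \<exists>B\<in>block ` Y. ?e A B = 0)"
    if "metric_subspace Y X d" for Y
  proof -
    have Y: "Y \<subseteq> X" using that by (simp add: metric_subspace_def)
    have "blocks = block ` X" by (auto simp: quotient_def)
    then show ?thesis using Y reflection_dist_block by (auto simp: subset_iff)
  qed
  have 1: "(\<forall>Y. metric_subspace Y X d \<longrightarrow> card Y = 3 \<longrightarrow> strongly_rigid_metric Y d) \<longleftrightarrow>
    (\<forall>Z. metric_subspace Z blocks ?e \<longrightarrow> card Z = 3 \<longrightarrow> strongly_rigid_metric Z ?e)"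
    by (rule all_metric_subspace_reflection) (simp only: strongly_rigid_metric_block card_block_image)
  have 2: "(\<forall>Y. metric_subspace Y X d \<longrightarrow> (\<forall>Z. metric_subspace Z X d \<longrightarrow>
      card Y = 3 \<longrightarrow> card Z = 3 \<longrightarrow> isometric_sets d Y Z)) \<longleftrightarrow>
    (\<forall>Y. metric_subspace Y blocks ?e \<longrightarrow> (\<forall>Z. metric_subspace Z blocks ?e \<longrightarrow>
      card Y = 3 \<longrightarrow> card Z = 3 \<longrightarrow> isometric_sets ?e Y Z))"
    \<comment> \<open>One application for each of the two nested quantifiers.\<close>
    by (rule all_metric_subspace_reflection, rule all_metric_subspace_reflection)
      (simp only: isometric_sets_block card_block_image)
  have 3: "(\<forall>Y. metric_subspace Y X d \<longrightarrow> \<not> (card Y = 4 \<and> (\<forall>x\<in>X. \<exists>y\<in>Y. d x y = 0))) \<longleftrightarrow>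
    (\<forall>Z. metric_subspace Z blocks ?e \<longrightarrow> \<not> (card Z = 4 \<and> (\<forall>A\<in>blocks. \<exists>B\<in>Z. ?e A B = 0)))"
    by (rule all_metric_subspace_reflection) (simp only: dense card_block_image)
  show ?thesis
    unfolding pseudorectangle_iff 1 2 3 ..
qed

section \<open>Self-similarities of the pseudometric space and cardinalities of blocks\<close>

lemma PI_subset_Cs: "PI X d \<subseteq> Cs X d"
proof
  fix \<psi> assume "\<psi> \<in> PI X d"
  then have B: "\<psi> \<in> Bij X" and z: "\<And>x. x \<in> X \<Longrightarrow> d x (\<psi> x) = 0" by (auto simp: PI_def)
  \<comment> \<open>Each point stays in its block, and distances depend only on the blocks.\<close>
  have "d (\<psi> x) (\<psi> y) = d x y" if "x \<in> X" "y \<in> X" for x y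
    using that reflection_dist_block Bij_mem[OF B] block_eq_iff z by metis
  with B show "\<psi> \<in> Cs X d" unfolding Cs_iff by simp
qed

lemma bij_betw_block_Cs:
  assumes C: "\<psi> \<in> Cs X d" and x: "x \<in> X"
  shows "bij_betw \<psi> (block x) (block (\<psi> x))"
proof -
  have B: "\<psi> \<in> Bij X" and E: "\<And>x y u v. \<lbrakk>x \<in> X; y \<in> X; u \<in> X; v \<in> X\<rbrakk> \<Longrightarrow>
    d x y = d u v \<longleftrightarrow> d (\<psi> x) (\<psi> y) = d (\<psi> u) (\<psi> v)" using C unfolding Cs_iff by blast+
  have z: "d a a = 0" if "a \<in> X" for a using P that unfolding pseudometric_on_def by blast
  \<comment> \<open>Distance 0 is recognised by comparison with \<open>d x x\<close>, so
    \<open>\<psi>\<close> preserves and reflects it.\<close>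
  have E0: "d x y = 0 \<longleftrightarrow> d (\<psi> x) (\<psi> y) = 0" if "y \<in> X" for y
    using E[of x y x x] z x that Bij_mem[OF B x] by simp
  have "inj_on \<psi> (block x)"
    using Bij_eq_iff[OF B] by (auto simp: inj_on_def zero_dist_rel_def)
  moreover have "\<psi> ` block x = block (\<psi> x)"
  proof
    show "\<psi> ` block x \<subseteq> block (\<psi> x)"
      using E0 x Bij_mem[OF B] by (auto simp: zero_dist_rel_def)
    show "block (\<psi> x) \<subseteq> \<psi> ` block x"
    proof
      fix w assume "w \<in> block (\<psi> x)"
      then have w: "w \<in> X" "d (\<psi> x) w = 0" by (auto simp: zero_dist_rel_def)
      then obtain y where "y \<in> X" "w = \<psi> y"
        using bij_betw_imp_surj_on[OF Bij_bij_betw[OF B]] by blast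
      with w E0 x show "w \<in> \<psi> ` block x" by (auto simp: zero_dist_rel_def)
    qed
  qed
  ultimately show ?thesis by (simp add: bij_betw_def)
qed

text \<open>A self-similarity maps the block of \<open>x\<close> bijectively onto the block of its
  image; these blocks are equipotent, hence equal, so the point moves by distance 0.\<close>

lemma Cs_eq_PI_if_not_eqpoll:
  assumes "\<And>A A'. A \<in> blocks \<Longrightarrow> A' \<in> blocks \<Longrightarrow> A \<approx> A' \<Longrightarrow> A = A'"
  shows "Cs X d = PI X d"
proof
  show "Cs X d \<subseteq> PI X d"
  proof
    fix \<psi> assume C: "\<psi> \<in> Cs X d"
    then have B: "\<psi> \<in> Bij X" by (simp add: Cs_def)
    have "d x (\<psi> x) = 0" if x: "x \<in> X" for x
      using assms[OF block_mem[OF x] block_mem[OF Bij_mem[OF B x]]] bij_betw_block_Cs[OF C x]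
        block_eq_iff[OF x Bij_mem[OF B x]] unfolding eqpoll_def by blast
    with B show "\<psi> \<in> PI X d" by (simp add: PI_def)
  qed
qed (rule PI_subset_Cs)

text \<open>Exchanging two equipotent blocks along a bijection induces a transposition of blocks. As
  the latter is a self-similarity by \<open>S\<close>, so is the exchange; but it moves points out
  of their blocks and cannot be a pseudoidentity.\<close>

lemma not_eqpoll_if_Cs_eq_PI:
  assumes C: "Cs X d = PI X d" and S: "Cs blocks (reflection_dist d) = Bij blocks"
    and A: "A \<in> blocks" and A': "A' \<in> blocks" and q: "A \<approx> A'"
  shows "A = A'"
proof (rule ccontr)
  assume ne: "A \<noteq> A'"
  obtain g where g: "bij_betw g A A'" using q unfolding eqpoll_def by blast
  have disj: "x \<notin> A" if "x \<in> A'" for x using block_eq A A' ne that by metis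
  have sub: "A \<subseteq> X" "A' \<subseteq> X" using block_eq A A' by blast+
  define h where "h = inv_into A g"
  have h: "\<And>y. y \<in> A' \<Longrightarrow> h y \<in> A \<and> g (h y) = y" "\<And>x. x \<in> A \<Longrightarrow> g x \<in> A' \<and> h (g x) = x"
    using g bij_betwE[OF g] bij_betwE[OF bij_betw_inv_into[OF g]]
    by (auto simp: h_def bij_betw_inv_into_right bij_betw_inv_into_left)
  define \<psi> where "\<psi> = (\<lambda>x\<in>X. if x \<in> A then g x else if x \<in> A' then h x else x)"
  have "bij_betw \<psi> X X"
    \<comment> \<open>The exchange is an involution, hence its own inverse.\<close>
    by (rule bij_betw_byWitness[where f' = \<psi>])
      (use h sub disj in \<open>auto simp: \<psi>_def subset_iff\<close>)
  then have B: "\<psi> \<in> Bij X" by (simp add: Bij_def \<psi>_def)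
  define \<sigma> where "\<sigma> = restrict (transpose A A') blocks"
  have "bij_betw (transpose A A') blocks blocks"
    by (rule bij_betw_byWitness[where f' = "transpose A A'"])
      (use A A' in \<open>auto simp: transpose_def\<close>)
  then have "\<sigma> \<in> Bij blocks" by (simp add: Bij_def \<sigma>_def bij_betw_restrict_eq)
  then have \<sigma>: "\<sigma> \<in> Cs blocks (reflection_dist d)" using S by simp
  have b: "block (\<psi> x) = \<sigma> (block x)" if x: "x \<in> X" for x
  proof -
    consider "x \<in> A" | "x \<in> A'" "x \<notin> A" | "x \<notin> A" "x \<notin> A'" by blast
    then show ?thesis
    proof cases
      case 1
      then have "block x = A" "block (g x) = A'" using block_eq A A' h by blast+
      with 1 x A show ?thesis by (simp add: \<psi>_def \<sigma>_def)
    next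
      case 2
      then have "block x = A'" "block (h x) = A" using block_eq A A' h by blast+
      with 2 x A' show ?thesis by (simp add: \<psi>_def \<sigma>_def)
    next
      case 3
      then have "block x \<noteq> A" "block x \<noteq> A'" using block_self[OF x] by blast+
      with 3 x block_mem[OF x] show ?thesis by (simp add: \<psi>_def \<sigma>_def)
    qed
  qed
  have "\<psi> \<in> Cs X d"
    unfolding Cs_iff
  proof (intro conjI ballI)
    fix x y u v assume m: "x \<in> X" "y \<in> X" "u \<in> X" "v \<in> X"
    let ?e = "reflection_dist d"
    \<comment> \<open>Since \<open>\<psi>\<close> lifts \<open>\<sigma>\<close>, equality of
      distances in \<open>X\<close> can be tested in the reflection.\<close>
    have D: "d (\<psi> s) (\<psi> t) = ?e (\<sigma> (block s)) (\<sigma> (block t))" if "s \<in> X" "t \<in> X" for s t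
      using that reflection_dist_block[of "\<psi> s" "\<psi> t"] Bij_mem[OF B] b by simp
    have "?e (block x) (block y) = ?e (block u) (block v) \<longleftrightarrow>
       ?e (\<sigma> (block x)) (\<sigma> (block y)) = ?e (\<sigma> (block u)) (\<sigma> (block v))"
      using \<sigma> m block_mem unfolding Cs_iff by blast
    then show "d x y = d u v \<longleftrightarrow> d (\<psi> x) (\<psi> y) = d (\<psi> u) (\<psi> v)"
      using m by (simp add: D reflection_dist_block)
  qed (rule B)
  then have z: "d x (\<psi> x) = 0" if "x \<in> X" for x using C that by (simp add: PI_def)
  obtain x where x: "x \<in> A" using in_quotient_imp_non_empty[OF equiv_zero_dist_rel[OF P] A] by blast
  then have xX: "x \<in> X" using sub by blast
  have "block x = block (\<psi> x)" using z[OF xX] block_eq_iff[OF xX Bij_mem[OF B xX]] by blast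
  moreover have "\<psi> x = g x" using x xX by (simp add: \<psi>_def)
  ultimately show False using block_eq[OF A x] block_eq[OF A', of "g x"] h(2)[OF x] ne by simp
qed

end

theorem theorem4p6:
  fixes X :: "'a set" and d :: "'a \<Rightarrow> 'a \<Rightarrow> real"
    and J :: "'j set" and B :: "'j \<Rightarrow> 'a set"
  assumes "X \<noteq> {}"
    and "pseudometric_on X d"
    and "B ` J = X // zero_dist_rel X d"
    and "inj_on B J"
  shows "(X, d) \<in> IP \<longleftrightarrow>
           (\<forall>j1\<in>J. \<forall>j2\<in>J. j1 \<noteq> j2 \<longrightarrow> \<not> B j1 \<approx> B j2) \<and>
           (strongly_rigid X d \<or> discrete_pseudometric X d \<or> pseudorectangle X d)"
proof -
  let ?Q = "X // zero_dist_rel X d" and ?e = "reflection_dist d"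
  note P = assms(2) and M = metric_on_reflection[OF assms(2)]
  have blocks: "(\<forall>j1\<in>J. \<forall>j2\<in>J. j1 \<noteq> j2 \<longrightarrow> \<not> B j1 \<approx> B j2) \<longleftrightarrow>
    (\<forall>A\<in>?Q. \<forall>A'\<in>?Q. A \<approx> A' \<longrightarrow> A = A')"
    unfolding assms(3)[symmetric] using assms(4) by (auto simp: inj_on_def)
  have "Cs ?Q ?e = Bij ?Q \<longleftrightarrow>
    strongly_rigid X d \<or> discrete_pseudometric X d \<or> pseudorectangle X d"
    unfolding Cs_eq_Bij_iff[OF M] strongly_rigid_reflection[OF P] discrete_reflection[OF P]
      pseudorectangle_reflection[OF P] strongly_rigid_iff_metric[OF M]
      discrete_pseudometric_iff_metric[OF M] ..
  \<comment> \<open>The exchange of blocks relies on the condition on the reflection. Assuming it is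
    harmless: it is part of \<open>IP\<close> and, by the previous equivalence, also of the
    right-hand side.\<close>
  moreover have "Cs X d = PI X d \<longleftrightarrow> (\<forall>A\<in>?Q. \<forall>A'\<in>?Q. A \<approx> A' \<longrightarrow> A = A')"
    if "Cs ?Q ?e = Bij ?Q"
    using Cs_eq_PI_if_not_eqpoll[OF P] not_eqpoll_if_Cs_eq_PI[OF P _ that] by metis
  ultimately show ?thesis
    unfolding blocks IP_def using P by auto
qed

end
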